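(* Let $T=T(r,l)$ be a finite labeled rooted tree with root $r$ and labeling $l:V(T)\to\mathbb{R}^+$, and let $L(T(r))$ be the set of leaves of $T(r)$. Then the following two statements are equivalent. (i) The rooted tree $T(r)$ is a perfect binary tree; the equality $l(v)=0$ holds for each $v\in L(T(r))$; the equivalence $$\operatorname{lev}_{T(r)}(w)=\operatorname{lev}_{T(r)}(x)\iff l(w)=l(x)$$ is valid for all $w,x\in V(T)$; and, moreover, the inequality $l(z)<l(y)$ holds whenever $y,z\in V(T)$ and $z$ is a direct successor of $y$. (ii) There exists an $\mathbf{MCD}$-space $(X,d)$ for which the representing tree $T_X=T_X(r_X,l_X)$ and $T=T(r,l)$ are isomorphic as labeled rooted trees.
   Context: $\mathbb{R}^+=[0,\infty)$. An ultrametric space is a metric space $(X,d)$ with $X$ non-empty whose metric satisfies $d(x,y)\le\max\{d(x,z),d(z,y)\}$ for all $x,y,z\in X$. The distance set is $D(X)=\{d(x,y):x,y\in X\}$ (so $0\in D(X)$). The center of distances $C(X)$ is the set of all $t\in D(X)$ such that for each $p\in X$ there exists $x\in X$ with $d(p,x)=t$. An $\mathbf{MCD}$-space is a finite ultrametric space $(X,d)$ satisfying $|X|=2^{|C(X)|-1}$. Rooted trees. A tree is a connected acyclic graph; a rooted tree $T(r)$ is a tree $T$ with a distinguished vertex $r$, the root. The level $\operatorname{lev}_{T(r)}(v)$ of a vertex $v$ is the number of edges of the unique path joining $v$ and $r$ (so $\operatorname{lev}_{T(r)}(r)=0$). For $v\neq r$, the direct predecessor of $v$ is the vertex $u$ on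 the path from $v$ to $r$ with $\operatorname{lev}(v)=1+\operatorname{lev}(u)$; then $v$ is a direct successor of $u$. The out-degree $\delta^+_{T(r)}(v)$ is the degree of $v$ in $T$ if $v=r$, and this degree minus $1$ otherwise. A leaf of $T(r)$ is a vertex of out-degree $0$. A binary tree is a rooted tree in which every vertex is either a leaf or has out-degree exactly $2$; it is perfect if all its leaves have the same level. Labeled trees. A labeled rooted tree $T(r,l)$ is a rooted tree $T(r)$ with a labeling $l:V(T)\to\mathbb{R}^+$. An isomorphism of labeled rooted trees $T_1(r_1,l_1)$ and $T_2(r_2,l_2)$ is a bijection $F:V(T_1)\to V(T_2)$ which preserves adjacency in both directions and satisfies $F(r_1)=r_2$ and $l_2(F(v))=l_1(v)$ for all $v\in V(T_1)$. Representing tree. For a finite metric space $(X,d)$ with $|X|\ge2$, the diametrical graph $G_X$ has vertex set $X$, with $u,v$ adjacent iff $d(u,v)=\operatorname{diam}X$. For a finite ultrametric space with $|X|\ge 2$, $G_X$ is a complete multipartite graph, i.e. for some $k\ge2$ the set $X$ is partitioned into non-empty parts $X_1,\dots,X_k$ such that two points are adjacent in $G_X$ iff they lie in different parts. The representing tree $T_X=T_X(r_X,l_X)$ of a finite ultrametric space $(X,d)$ is the labeled rooted tree whose vertices are subsets of $X$, constructed as follows: the root is $r_X:=X$ with label $l_X(X)=\operatorname{diam}X$; if $|X|=1$ the root is the only vertex; if $|X|\geq 2$, the direct successors of the root are the parts $X_1,\dots,X_k$ of $G_X$, labeled by $l_X(X_i)=\operatorname{diam}X_i$; nodes with label $0$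 are leaves, and the procedure is repeated for each node $X_i$ of positive label, using the space $(X_i,d|_{X_i\times X_i})$, until all remaining nodes are leaves. *)

theory Defs
  imports
    "HOL-Analysis.Abstract_Metric_Spaces"
    "HOL-Library.Disjoint_Sets"
    "HOL-Library.Infinite_Typeclass"
    "Graph_Theory.Digraph_Component"
begin

section \<open>Finite ultrametric spaces\<close>

locale ultrametric_space = Metric_space M d for M :: "'a set" and d :: "'a \<Rightarrow> 'a \<Rightarrow> real" +
  assumes carrier_nonempty: "M \<noteq> {}"
    and ultrametric:
      "\<And>x y z. \<lbrakk>x \<in> M; y \<in> M; z \<in> M\<rbrakk> \<Longrightarrow> d x y \<le> max (d x z) (d z y)"

definition distance_set :: "'a set \<Rightarrow> ('a \<Rightarrow> 'a \<Rightarrow> real) \<Rightarrow> real set" where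
  "distance_set X d = {d x y | x y. x \<in> X \<and> y \<in> X}"

definition center_of_distances :: "'a set \<Rightarrow> ('a \<Rightarrow> 'a \<Rightarrow> real) \<Rightarrow> real set" where
  "center_of_distances X d = {t \<in> distance_set X d. \<forall>p\<in>X. \<exists>x\<in>X. d p x = t}"

text \<open>Since 0 lies in the center of distances of a non-empty space, the subtraction of natural
  numbers below does not truncate.\<close>

definition MCD_space :: "'a set \<Rightarrow> ('a \<Rightarrow> 'a \<Rightarrow> real) \<Rightarrow> bool" where
  "MCD_space X d \<longleftrightarrow>
     ultrametric_space X d \<and> finite X \<and> card X = 2 ^ (card (center_of_distances X d) - 1)"

definition mdiam :: "('a \<Rightarrow> 'a \<Rightarrow> real) \<Rightarrow> 'a set \<Rightarrow> real" where
  "mdiam d A = Sup (distance_set A d)"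


section \<open>Rooted trees\<close>

text \<open>Finite simple graphs are represented as in \<^locale>\<open>pair_graph\<close>: an undirected edge
  between u and v is the pair of arcs (u, v) and (v, u). Under this representation every edge gives
  a closed walk of length 2 that \<^const>\<open>pre_digraph.cycle\<close> accepts, so the undirected cycles are
  those of length at least 3 (and \<^const>\<open>tree\<close> is not the notion needed here).\<close>

definition undirected_tree :: "'v pair_pre_digraph \<Rightarrow> bool" where
  "undirected_tree G \<longleftrightarrow>
     pair_graph G \<and> Digraph_Component.connected (with_proj G) \<and>
     \<not> (\<exists>p. pre_digraph.cycle (with_proj G) p \<and> 3 \<le> length p)"

definition rooted_tree :: "'v pair_pre_digraph \<Rightarrow> 'v \<Rightarrow> bool" where
  "rooted_tree G r \<longleftrightarrow> undirected_tree G \<and> r \<in> pverts G"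

definition path_to_root :: "'v pair_pre_digraph \<Rightarrow> 'v \<Rightarrow> 'v \<Rightarrow> ('v \<times> 'v) list" where
  "path_to_root G r v = (THE p. pre_digraph.apath (with_proj G) v p r)"

definition lev :: "'v pair_pre_digraph \<Rightarrow> 'v \<Rightarrow> 'v \<Rightarrow> nat" where
  "lev G r v = length (path_to_root G r v)"

definition direct_successor :: "'v pair_pre_digraph \<Rightarrow> 'v \<Rightarrow> 'v \<Rightarrow> 'v \<Rightarrow> bool" where
  "direct_successor G r v u \<longleftrightarrow>
     v \<in> pverts G \<and> v \<noteq> r \<and>
     u \<in> set (pre_digraph.awalk_verts (with_proj G) v (path_to_root G r v)) \<and>
     lev G r v = 1 + lev G r u"

text \<open>For a symmetric digraph, \<^const>\<open>out_degree\<close> is the degree in the undirected graph.\<close>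

definition tree_out_degree :: "'v pair_pre_digraph \<Rightarrow> 'v \<Rightarrow> 'v \<Rightarrow> nat" where
  "tree_out_degree G r v =
     (if v = r then out_degree (with_proj G) v else out_degree (with_proj G) v - 1)"

definition tree_leaves :: "'v pair_pre_digraph \<Rightarrow> 'v \<Rightarrow> 'v set" where
  "tree_leaves G r = {v \<in> pverts G. tree_out_degree G r v = 0}"

definition binary_tree :: "'v pair_pre_digraph \<Rightarrow> 'v \<Rightarrow> bool" where
  "binary_tree G r \<longleftrightarrow>
     rooted_tree G r \<and> (\<forall>v\<in>pverts G. v \<in> tree_leaves G r \<or> tree_out_degree G r v = 2)"

definition perfect_binary_tree :: "'v pair_pre_digraph \<Rightarrow> 'v \<Rightarrow> bool" where
  "perfect_binary_tree G r \<longleftrightarrow>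
     binary_tree G r \<and> (\<forall>v\<in>tree_leaves G r. \<forall>w\<in>tree_leaves G r. lev G r v = lev G r w)"

definition labeled_tree_isomorphic ::
  "'v pair_pre_digraph \<Rightarrow> 'v \<Rightarrow> ('v \<Rightarrow> real) \<Rightarrow> 'w pair_pre_digraph \<Rightarrow> 'w \<Rightarrow> ('w \<Rightarrow> real) \<Rightarrow> bool"
where
  "labeled_tree_isomorphic G\<^sub>1 r\<^sub>1 l\<^sub>1 G\<^sub>2 r\<^sub>2 l\<^sub>2 \<longleftrightarrow>
     (\<exists>F. bij_betw F (pverts G\<^sub>1) (pverts G\<^sub>2) \<and>
          (\<forall>u\<in>pverts G\<^sub>1. \<forall>v\<in>pverts G\<^sub>1. (u, v) \<in> parcs G\<^sub>1 \<longleftrightarrow> (F u, F v) \<in> parcs G\<^sub>2) \<and>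
          F r\<^sub>1 = r\<^sub>2 \<and>
          (\<forall>v\<in>pverts G\<^sub>1. l\<^sub>2 (F v) = l\<^sub>1 v))"


section \<open>The representing tree\<close>

definition diametrical_graph :: "('a \<Rightarrow> 'a \<Rightarrow> real) \<Rightarrow> 'a set \<Rightarrow> 'a pair_pre_digraph" where
  "diametrical_graph d A =
     \<lparr>pverts = A, parcs = {(u, v). u \<in> A \<and> v \<in> A \<and> d u v = mdiam d A}\<rparr>"

definition complete_multipartite_with :: "'a pair_pre_digraph \<Rightarrow> 'a set set \<Rightarrow> bool" where
  "complete_multipartite_with G P \<longleftrightarrow>
     partition_on (pverts G) P \<and> 2 \<le> card P \<and>
     (\<forall>u\<in>pverts G. \<forall>v\<in>pverts G. (u, v) \<in> parcs G \<longleftrightarrow> \<not> (\<exists>B\<in>P. u \<in> B \<and> v \<in> B))"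

text \<open>\<open>splits_into d A B\<close>: B is one of the nodes into which the construction splits the node A.
  The partition P is determined by the diametrical graph, and a finite node has at least two points
  iff its diameter is positive.\<close>

definition splits_into :: "('a \<Rightarrow> 'a \<Rightarrow> real) \<Rightarrow> 'a set \<Rightarrow> 'a set \<Rightarrow> bool" where
  "splits_into d A B \<longleftrightarrow>
     0 < mdiam d A \<and> (\<exists>P. complete_multipartite_with (diametrical_graph d A) P \<and> B \<in> P)"

inductive_set rep_nodes :: "('a \<Rightarrow> 'a \<Rightarrow> real) \<Rightarrow> 'a set \<Rightarrow> 'a set set"
  for d :: "'a \<Rightarrow> 'a \<Rightarrow> real" and X :: "'a set" where
  root: "X \<in> rep_nodes d X"
| split: "\<lbrakk>A \<in> rep_nodes d X; splits_into d A B\<rbrakk> \<Longrightarrow> B \<in> rep_nodes d X"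

text \<open>The representing tree has this graph, the root \<open>X\<close> and the labeling \<open>mdiam d\<close>.\<close>

definition rep_tree :: "'a set \<Rightarrow> ('a \<Rightarrow> 'a \<Rightarrow> real) \<Rightarrow> 'a set pair_pre_digraph" where
  "rep_tree X d =
     \<lparr>pverts = rep_nodes d X,
      parcs = {(A, B). A \<in> rep_nodes d X \<and> B \<in> rep_nodes d X \<and>
                       (splits_into d A B \<or> splits_into d B A)}\<rparr>"

text \<open>A finite metric space has an isometric copy with carrier in any given infinite type, so the
  existence of a finite space may be asserted over an arbitrary type of class \<^class>\<open>infinite\<close>.\<close>

end

theory Submission
  imports Defs
begin

text \<open>Both sides of the equivalence describe the same object, a finite ultrametric space organised as a
dyadic hierarchy of balls.

Let \<open>0 = c\<^sub>0 < \<dots> < c\<^sub>n\<close> be the center of distances of an MCD-space \<open>X\<close>, so that \<open>|X| = 2\<^sup>n\<close>. A closed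
ball of radius \<open>c\<^sub>j\<^sub>+\<^sub>1\<close> around \<open>x\<close> contains a point \<open>y\<close> at distance exactly \<open>c\<^sub>j\<^sub>+\<^sub>1\<close> from \<open>x\<close>, and the balls of
radius \<open>c\<^sub>j\<close> around \<open>x\<close> and \<open>y\<close> are disjoint; so by induction it has at least \<open>2\<^sup>j\<^sup>+\<^sup>1\<close> points. As \<open>X\<close>
has only \<open>2\<^sup>n\<close> points, equality holds at every scale: each ball of radius \<open>c\<^sub>j\<^sub>+\<^sub>1\<close> is the union of
exactly two balls of radius \<open>c\<^sub>j\<close>, and every distance is one of the \<open>c\<^sub>j\<close> (\<open>dyadic_of_MCD\<close>). The
converse count is easy (\<open>dyadic_space.MCD_space\<close>). In such a space the nodes of the representing
tree are the balls of radius \<open>c\<^sub>j\<close> (\<open>rep_nodes_eq\<close>); such a ball has diameter \<open>c\<^sub>j\<close> and level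
\<open>n - j\<close>, and splits into its two halves. This gives the properties in (i).

Conversely, let a tree satisfy (i) and have leaves of level \<open>n\<close>. Let the distance of two leaves be
the label of their lowest common ancestor. Since labels depend on the level only and increase towards
the root, this is an ultrametric; since each inner vertex has two children, it is dyadic, and a
vertex corresponds to the ball of the leaves below it (\<open>leaf_space\<close>).

Levels and successors are defined by paths, whereas the representing tree is given by a relation
between a node and its parts. The two are matched by \<open>hierarchy\<close>: a level function and a child relation
that describe the edges. A rooted tree carries such data (\<open>hierarchy_of_rooted_tree\<close>), and
they are determined by the graph and the root (\<open>hierarchy_lvl_isomorphic\<close>), so that no path in
the representing tree ever has to be considered.\<close>

section \<open>Paths in acyclic graphs\<close>

lemma (in pair_pre_digraph) cycle_iff:
  "cycle p \<longleftrightarrow> (\<exists>u. awalk u p u \<and> distinct (tl (pawalk_verts u p)) \<and> p \<noteq> [])"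
  by (simp add: cycle_def)

lemma (in pair_wf_digraph) apath_Cons:
  "apath u ((a, b) # p) v \<longleftrightarrow>
     a = u \<and> (u, b) \<in> parcs G \<and> apath b p v \<and> u \<notin> set (pawalk_verts b p)"
  by (auto simp: apath_Cons_iff)

text \<open>Two paths with the same ends that leave \<open>u\<close> along different edges to \<open>a\<close> and \<open>b\<close> form a walk from \<open>a\<close>
to \<open>b\<close> that avoids \<open>u\<close>. Shortened to a path and closed up through \<open>u\<close>, it is a cycle of length at
least 3.\<close>

lemma (in pair_graph) apath_unique_if_acyclic:
  assumes acyclic: "\<not> (\<exists>p. cycle p \<and> 3 \<le> length p)"
    and p: "apath u p v" and q: "apath u q v"
  shows "p = q"
  using p q
proof (induction p arbitrary: u q)
  case Nil
  then have "u = v" by (simp add: apath_Nil_iff)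
  with Nil.prems(2) show ?case using apath_nonempty_ends by blast
next
  case (Cons e p)
  obtain a where e: "e = (u, a)" and ua: "(u, a) \<in> parcs G" and p: "apath a p v"
    and up: "u \<notin> set (pawalk_verts a p)"
    using Cons.prems(1) by (cases e) (auto simp: apath_Cons)
  have "u \<noteq> v" using apath_nonempty_ends[OF Cons.prems(1)] by simp
  then obtain e' q' where "q = e' # q'"
    using Cons.prems(2) by (cases q) (auto simp: apath_Nil_iff)
  then obtain b where q: "q = (u, b) # q'" and ub: "(u, b) \<in> parcs G" and q': "apath b q' v"
    and uq: "u \<notin> set (pawalk_verts b q')"
    using Cons.prems(2) by (cases e') (auto simp: apath_Cons)
  show ?case
  proof (cases "a = b")
    case True
    then show ?thesis using Cons.IH[OF p] q' e q by simp
  next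
    case False
    \<comment> \<open>walk from \<open>a\<close> to \<open>v\<close> and back to \<open>b\<close>, avoiding \<open>u\<close>\<close>
    let ?w = "p @ rev_path q'"
    have wp: "awalk a p v" and wq: "awalk v (rev_path q') b"
      using awalkI_apath[OF p] awalkI_apath[OF q'] by simp_all
    have w: "awalk a ?w b" using awalk_appendI[OF wp wq] .
    have "u \<notin> set (pawalk_verts v (rev_path q'))"
      using uq awalk_verts_rev_path[OF awalkI_apath[OF q']] by simp
    with up have uw: "u \<notin> set (pawalk_verts a ?w)"
      using set_awalk_verts_append[OF wp wq] by simp
    define s where "s = awalk_to_apath ?w"
    have s: "apath a s b" and sw: "set s \<subseteq> set ?w"
      unfolding s_def by (rule apath_awalk_to_apath[OF w], rule awalk_to_apath_subset[OF w])
    have us: "u \<notin> set (pawalk_verts a s)"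
    proof -
      have "set (pawalk_verts a s) \<subseteq> set (pawalk_verts a ?w)"
        unfolding set_awalk_verts[OF w] set_awalk_verts[OF awalkI_apath[OF s]]
        using image_mono[OF sw, of fst] image_mono[OF sw, of snd] by auto
      then show ?thesis using uw by blast
    qed
    have "s \<noteq> []" using s False by (auto simp: apath_Nil_iff)
    have bu: "(b, u) \<in> parcs G" using ub by (rule arcs_symmetric)
    let ?c = "(u, a) # s @ [(b, u)]"
    have "awalk b [(b, u)] u" using bu arc_implies_awalk[OF bu] by simp
    then have "awalk a (s @ [(b, u)]) u" using awalk_appendI[OF awalkI_apath[OF s]] by blast
    moreover from this have "pawalk_verts a (s @ [(b, u)]) = pawalk_verts a s @ [u]"
      using awalk_verts_append[of a s "[(b, u)]" u] by simp
    ultimately have "cycle ?c"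
      unfolding cycle_iff using ua us s
      by (intro exI[of _ u]) (simp add: awalk_Cons_iff apath_def)
    moreover have "3 \<le> length ?c" using \<open>s \<noteq> []\<close> by (cases s) auto
    ultimately show ?thesis using acyclic by blast
  qed
qed

section \<open>Rooted trees as level and child relations\<close>

text \<open>A description of a rooted tree without paths: the edges join each non-root vertex to a unique parent
one level above it.\<close>

locale hierarchy =
  fixes G :: "'v pair_pre_digraph" and r :: 'v
    and lvl :: "'v \<Rightarrow> nat" and child :: "'v \<Rightarrow> 'v \<Rightarrow> bool"
  assumes root_in: "r \<in> pverts G"
    and lvl_root: "lvl r = 0"
    and arc_iff: "\<lbrakk>u \<in> pverts G; v \<in> pverts G\<rbrakk> \<Longrightarrow> (u, v) \<in> parcs G \<longleftrightarrow> child u v \<or> child v u"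
    and lvl_child: "\<lbrakk>u \<in> pverts G; v \<in> pverts G; child u v\<rbrakk> \<Longrightarrow> lvl v = Suc (lvl u)"
    and parent_unique:
      "\<lbrakk>u \<in> pverts G; u' \<in> pverts G; v \<in> pverts G; child u v; child u' v\<rbrakk> \<Longrightarrow> u = u'"
    and parent_exists: "\<lbrakk>v \<in> pverts G; v \<noteq> r\<rbrakk> \<Longrightarrow> \<exists>u\<in>pverts G. child u v"

text \<open>An isomorphism of graphs with hierarchies that preserves the root preserves levels, because a level
is a distance to the root. With \<open>F = id\<close>, and since the levels orient the edges, it follows that a
graph and a root have at most one hierarchy. The induction on the level only has to exclude that the edge from \<open>v\<close> to its parent \<open>u\<close>
is mapped upside down: then \<open>F v\<close> would be the parent of \<open>F u\<close>, as is \<open>F w\<close> for the parent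
\<open>w\<close> of \<open>u\<close>.\<close>

lemma hierarchy_lvl_isomorphic:
  assumes "hierarchy G r lvl child" and "hierarchy G' r' lvl' child'"
    and F: "bij_betw F (pverts G) (pverts G')" "F r = r'"
    and adj: "\<forall>u\<in>pverts G. \<forall>v\<in>pverts G. (u, v) \<in> parcs G \<longleftrightarrow> (F u, F v) \<in> parcs G'"
    and v: "v \<in> pverts G"
  shows "lvl' (F v) = lvl v"
proof -
  interpret H: hierarchy G r lvl child by fact
  interpret H': hierarchy G' r' lvl' child' by fact
  have FV: "F u \<in> pverts G'" if "u \<in> pverts G" for u
    using F(1) that by (auto simp: bij_betw_def)
  have edge: "child' (F a) (F b) \<or> child' (F b) (F a)"
    if "a \<in> pverts G" "b \<in> pverts G" "child a b" for a b
    using that adj H.arc_iff[of a b] H'.arc_iff[of "F a" "F b"] FV by blast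
  show ?thesis using v
  proof (induction "lvl v" arbitrary: v rule: less_induct)
    case less
    show ?case
    proof (cases "v = r")
      case True
      then show ?thesis using F(2) H.lvl_root H'.lvl_root by simp
    next
      case False
      then obtain u where u: "u \<in> pverts G" "child u v" using H.parent_exists less.prems by blast
      have lv: "lvl v = Suc (lvl u)" using H.lvl_child u less.prems by blast
      then have lu: "lvl' (F u) = lvl u" using less.hyps u by simp
      have "\<not> child' (F v) (F u)"
      proof
        assume c: "child' (F v) (F u)"
        then have "lvl' (F u) \<noteq> 0" using H'.lvl_child FV less.prems u by fastforce
        then have "u \<noteq> r" using F(2) H'.lvl_root by metis
        then obtain w where w: "w \<in> pverts G" "child w u" using H.parent_exists u by blast
        have lw: "lvl u = Suc (lvl w)" using H.lvl_child u w by blast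
        then have lw': "lvl' (F w) = lvl w" using less.hyps lv w by simp
        have "\<not> child' (F u) (F w)"
          using H'.lvl_child[of "F u" "F w"] FV u w lu lw lw' by auto
        then have "child' (F w) (F u)" using edge w u by blast
        then have "F w = F v" using H'.parent_unique[OF _ _ _ _ c] FV w u less.prems by blast
        then have "w = v" using F(1) w less.prems by (auto simp: bij_betw_def inj_on_def)
        then show False using lv lw by simp
      qed
      then have "child' (F u) (F v)" using edge u less.prems by blast
      then show ?thesis using H'.lvl_child[of "F u" "F v"] FV u less.prems lu lv by simp
    qed
  qed
qed

lemma (in hierarchy) child_iff:
  assumes "u \<in> pverts G" "v \<in> pverts G"
  shows "child u v \<longleftrightarrow> (u, v) \<in> parcs G \<and> lvl v = Suc (lvl u)"
proof -
  have "\<not> child v u" if "lvl v = Suc (lvl u)"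
    using lvl_child[of v u] assms that by fastforce
  then show ?thesis using arc_iff[OF assms] lvl_child[OF assms] by blast
qed

lemma hierarchy_child_isomorphic:
  assumes "hierarchy G r lvl child" and "hierarchy G' r' lvl' child'"
    and F: "bij_betw F (pverts G) (pverts G')" "F r = r'"
    and adj: "\<forall>u\<in>pverts G. \<forall>v\<in>pverts G. (u, v) \<in> parcs G \<longleftrightarrow> (F u, F v) \<in> parcs G'"
    and uv: "u \<in> pverts G" "v \<in> pverts G"
  shows "child' (F u) (F v) \<longleftrightarrow> child u v"
proof -
  have "F u \<in> pverts G'" "F v \<in> pverts G'" using F(1) uv by (auto simp: bij_betw_def)
  then show ?thesis
    using hierarchy.child_iff[OF assms(1) uv] hierarchy.child_iff[OF assms(2), of "F u" "F v"]
      hierarchy_lvl_isomorphic[OF assms(1-5) uv(1)] hierarchy_lvl_isomorphic[OF assms(1-5) uv(2)]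
      adj uv by simp
qed

text \<open>By uniqueness of paths, \<open>v\<close> is a direct successor of \<open>u\<close> iff the path from \<open>v\<close> to the root
is the edge \<open>(v, u)\<close> followed by the path from \<open>u\<close>. Every edge has this form in one of its two
directions: either \<open>v\<close> is off the path of \<open>u\<close>, and the edge extends that path, or \<open>v\<close>
is on it, and the edge is its first step.\<close>

lemma hierarchy_of_rooted_tree:
  assumes "rooted_tree G r"
  shows "hierarchy G r (lev G r) (\<lambda>u v. direct_successor G r v u)"
proof -
  have pg: "pair_graph G" and con: "Digraph_Component.connected (with_proj G)"
    and acyc: "\<not> (\<exists>p. pre_digraph.cycle (with_proj G) p \<and> 3 \<le> length p)"
    and r: "r \<in> pverts G"
    using assms by (auto simp: rooted_tree_def undirected_tree_def)
  interpret pair_graph G by fact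
  let ?P = "path_to_root G r"
  have "strongly_connected (with_proj G)"
    using symmetric_connected_imp_strongly_connected con pair_sym_arcs by blast
  then have ex: "\<exists>p. apath v p r" if "v \<in> pverts G" for v
    using that r by (auto simp: strongly_connected_def reachable_apath)
  have uniq: "p = q" if "apath u p v" "apath u q v" for u v p q
    using apath_unique_if_acyclic[OF acyc that] .
  have P: "apath v (?P v) r" if "v \<in> pverts G" for v
    unfolding path_to_root_def by (rule theI') (use ex[OF that] uniq in blast)
  have Peq: "?P v = p" if "apath v p r" for v p
    using that P uniq awalk_hd_in_verts awalkI_apath by metis
  have Pr: "?P r = []" using r by (intro Peq) (simp add: apath_Nil_iff)
  have suffix: "p = q @ ?P w \<and> apath v q w"
    if "apath v (q @ s) r" "p = q @ s" "awlast v q = w" for v p q s w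
    using that Peq by (auto simp: apath_append_iff)
  have ds: "direct_successor G r v u \<longleftrightarrow> ?P v = (v, u) # ?P u"
    if v: "v \<in> pverts G" for u v
  proof
    assume d: "direct_successor G r v u"
    then have "u \<in> set (pawalk_verts v (?P v))" and l: "length (?P v) = Suc (length (?P u))"
      by (auto simp: direct_successor_def lev_def)
    then obtain q s where qs: "?P v = q @ s" "awalk v q u" "awalk u s r"
      using awalk_decomp[OF awalkI_apath[OF P[OF v]]] by blast
    have "awlast v q = u" using qs(2) by auto
    then have "?P v = q @ ?P u" "apath v q u" using suffix P[OF v] qs(1) by metis+
    moreover from this l obtain e where "q = [e]" by (cases q) auto
    ultimately show "?P v = (v, u) # ?P u" by (cases e) (auto simp: apath_simps)
  next
    assume e: "?P v = (v, u) # ?P u"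
    then have "v \<noteq> r" using Pr by auto
    moreover have "u \<in> set (pawalk_verts v (?P v))"
      unfolding e by (cases "?P u") (use P[OF v, unfolded e] in \<open>auto simp: apath_Cons\<close>)
    ultimately show "direct_successor G r v u"
      using v e by (auto simp: direct_successor_def lev_def)
  qed
  have arc: "?P v = (v, u) # ?P u \<or> ?P u = (u, v) # ?P v" if uv: "(u, v) \<in> parcs G" for u v
  proof (cases "v \<in> set (pawalk_verts u (?P u))")
    case False
    have "u \<in> pverts G" "(v, u) \<in> parcs G" using uv arcs_symmetric by (auto dest: in_arcsD1)
    then have "apath v ((v, u) # ?P u) r" using P False by (auto simp: apath_Cons)
    then show ?thesis using Peq by blast
  next
    case True
    have u: "u \<in> pverts G" "v \<in> pverts G" using uv by (auto dest: in_arcsD1 in_arcsD2)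
    obtain q s where qs: "?P u = q @ s" "awalk u q v" "awalk v s r"
      using awalk_decomp[OF awalkI_apath[OF P[OF u(1)]] True] by blast
    have "awlast u q = v" using qs(2) by auto
    then have "?P u = q @ ?P v" "apath u q v" using suffix P[OF u(1)] qs(1) by metis+
    moreover have "apath u [(u, v)] v" using uv u no_loops' by (auto simp: apath_simps)
    ultimately show ?thesis using uniq by fastforce
  qed
  show ?thesis
  proof
    show "r \<in> pverts G" "lev G r r = 0" using r Pr by (auto simp: lev_def)
  next
    fix u v assume uv: "u \<in> pverts G" "v \<in> pverts G"
    have "(u, v) \<in> parcs G" if "?P v = (v, u) # ?P u"
      using P[OF uv(2)] arcs_symmetric unfolding that by (auto simp: apath_Cons)
    moreover have "(u, v) \<in> parcs G" if "?P u = (u, v) # ?P v"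
      using P[OF uv(1)] unfolding that by (auto simp: apath_Cons)
    ultimately show "(u, v) \<in> parcs G \<longleftrightarrow> direct_successor G r v u \<or> direct_successor G r u v"
      using arc[of u v] ds uv by blast
    assume "direct_successor G r v u"
    then show "lev G r v = Suc (lev G r u)" by (simp add: direct_successor_def)
  next
    fix u u' v assume "v \<in> pverts G" "direct_successor G r v u" "direct_successor G r v u'"
    then show "u = u'" using ds by auto
  next
    fix v assume v: "v \<in> pverts G" "v \<noteq> r"
    then have "?P v \<noteq> []" using P[OF v(1)] by (auto simp: apath_Nil_iff)
    then obtain u p where e: "?P v = (v, u) # p" and up: "apath u p r" "(v, u) \<in> parcs G"
      using P[OF v(1)] by (cases "?P v") (auto simp: apath_Cons)
    then have "?P v = (v, u) # ?P u" using Peq by blast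
    then show "\<exists>u\<in>pverts G. direct_successor G r v u"
      using ds v up in_arcsD2 by blast
  qed
qed

lemma tree_out_degree_eq_card_successors:
  assumes "rooted_tree G r" and "v \<in> pverts G"
  shows "tree_out_degree G r v = card {w \<in> pverts G. direct_successor G r w v}"
proof -
  interpret hierarchy G r "lev G r" "\<lambda>u v. direct_successor G r v u"
    using assms(1) by (rule hierarchy_of_rooted_tree)
  interpret pair_graph G using assms(1) by (simp add: rooted_tree_def undirected_tree_def)
  let ?C = "{w \<in> pverts G. direct_successor G r w v}"
  let ?N = "{w \<in> pverts G. (v, w) \<in> parcs G}"
  have "out_arcs (with_proj G) v = Pair v ` ?N"
    by (auto simp: out_arcs_def image_iff dest: in_arcsD2)
  then have deg: "out_degree (with_proj G) v = card ?N"
    by (simp add: out_degree_def card_image inj_on_def)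
  have fin: "finite ?C" using pair_finite_verts by simp
  show ?thesis
  proof (cases "v = r")
    case True
    have "?N = ?C"
      using arc_iff[OF assms(2)] lvl_child[OF _ assms(2)] True lvl_root by fastforce
    then show ?thesis using deg True by (simp add: tree_out_degree_def)
  next
    case False
    then obtain u where u: "u \<in> pverts G" "direct_successor G r v u"
      using parent_exists assms(2) by blast
    have "?N = insert u ?C"
      using arc_iff[OF assms(2)] parent_unique[OF _ u(1) assms(2) _ u(2)] u by blast
    moreover have "u \<notin> ?C"
      using lvl_child[OF u(1) assms(2) u(2)] lvl_child[OF assms(2) u(1)] by fastforce
    ultimately show ?thesis using deg False fin by (simp add: tree_out_degree_def)
  qed
qed

section \<open>Balls in ultrametric spaces\<close>

context ultrametric_space
begin

lemma mcball_eq_of_mem: "mcball y t = mcball x t" if y: "y \<in> mcball x t"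
proof -
  have "d y z \<le> t \<longleftrightarrow> d x z \<le> t" if "z \<in> M" for z
    using ultrametric[of y z x] ultrametric[of x z y] y that commute[of x y] by (auto simp: in_mcball)
  then show ?thesis using y by (auto simp: in_mcball)
qed

lemma mcball_disjoint: "mcball x t \<inter> mcball y t = {}" if "t < d x y"
proof (rule ccontr)
  assume "mcball x t \<inter> mcball y t \<noteq> {}"
  then obtain z where "z \<in> mcball x t" "z \<in> mcball y t" by blast
  then show False using ultrametric[of x y z] commute[of y z] that by (auto simp: in_mcball)
qed

end

section \<open>Spaces in which every point realises a scale of distances\<close>

locale scaled_space = ultrametric_space M d for M :: "'a set" and d +
  fixes c :: "nat \<Rightarrow> real" and n :: nat
  assumes finite_carrier: "finite M"
    and scale_zero: "c 0 = 0"
    and scale_less: "\<lbrakk>i < j; j \<le> n\<rbrakk> \<Longrightarrow> c i < c j"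
    and scale_realised: "\<lbrakk>x \<in> M; j \<le> n\<rbrakk> \<Longrightarrow> \<exists>y\<in>M. d x y = c j"
begin

lemma scale_less_iff: "c i < c j \<longleftrightarrow> i < j" if "i \<le> n" "j \<le> n"
  using that scale_less[of i j] scale_less[of j i] by (cases i j rule: linorder_cases) auto

lemma scale_le_iff: "c i \<le> c j \<longleftrightarrow> i \<le> j" if "i \<le> n" "j \<le> n"
  using scale_less_iff[OF that(2,1)] by auto

lemma scale_eq_iff: "c i = c j \<longleftrightarrow> i = j" if "i \<le> n" "j \<le> n"
  using scale_less_iff[OF that] scale_less_iff[OF that(2,1)] by auto

lemma scale_nonneg: "j \<le> n \<Longrightarrow> 0 \<le> c j"
  using scale_le_iff[of 0 j] scale_zero by simp

lemma finite_mcball: "finite (mcball x t)"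
  using finite_carrier mcball_subset_mspace finite_subset by blast

lemma centre_mem: "\<lbrakk>x \<in> M; j \<le> n\<rbrakk> \<Longrightarrow> x \<in> mcball x (c j)"
  using scale_nonneg by simp

lemma mcball_zero: "x \<in> M \<Longrightarrow> mcball x (c 0) = {x}"
  using scale_zero by (auto simp: in_mcball) (metis nonneg zero order.antisym)

lemma two_balls_subset:
  assumes "Suc j \<le> n" "x \<in> M" "y \<in> M" "d x y = c (Suc j)"
  shows "mcball x (c j) \<union> mcball y (c j) \<subseteq> mcball x (c (Suc j))"
    and "mcball x (c j) \<inter> mcball y (c j) = {}"
proof -
  have less: "c j < c (Suc j)" using scale_less assms by simp
  have "mcball x (c (Suc j)) = mcball y (c (Suc j))"
    using mcball_eq_of_mem[of y x "c (Suc j)"] assms by (simp add: in_mcball)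
  then show "mcball x (c j) \<union> mcball y (c j) \<subseteq> mcball x (c (Suc j))"
    using less mcball_subset_concentric[of "c j" "c (Suc j)"] by auto
  show "mcball x (c j) \<inter> mcball y (c j) = {}" using mcball_disjoint less assms by simp
qed

text \<open>The lower bound on which the definition of MCD-spaces rests: passing from one value of the scale to
the next at least doubles the size of a ball.\<close>

lemma card_mcball_ge: "\<lbrakk>x \<in> M; j \<le> n\<rbrakk> \<Longrightarrow> 2 ^ j \<le> card (mcball x (c j))"
proof (induction j arbitrary: x)
  case 0
  then show ?case by (simp add: mcball_zero)
next
  case (Suc j)
  obtain y where y: "y \<in> M" "d x y = c (Suc j)" using scale_realised Suc.prems by blast
  note two = two_balls_subset[OF Suc.prems(2,1) y]
  have "2 ^ Suc j \<le> card (mcball x (c j)) + card (mcball y (c j))"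
    using Suc.IH[of x] Suc.IH[of y] Suc.prems y by simp
  also have "\<dots> = card (mcball x (c j) \<union> mcball y (c j))"
    using two(2) finite_mcball card_Un_disjoint by metis
  also have "\<dots> \<le> card (mcball x (c (Suc j)))" using two(1) finite_mcball card_mono by blast
  finally show ?case .
qed

end

text \<open>The last assumption excludes equilateral triangles of positive side, that is, it limits the number of
parts into which a ball of radius \<open>c\<^sub>j\<close> falls to two.\<close>

locale dyadic_space = scaled_space M d c n for M :: "'a set" and d c n +
  assumes dist_in_scale: "\<lbrakk>x \<in> M; y \<in> M\<rbrakk> \<Longrightarrow> \<exists>j\<le>n. d x y = c j"
    and no_equilateral:
      "\<lbrakk>x \<in> M; y \<in> M; z \<in> M; 0 < j; j \<le> n; d x y = c j; d x z = c j\<rbrakk> \<Longrightarrow> d y z < c j"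

text \<open>The extremal case of the bound \<open>card_mcball_ge\<close>. It will turn out to be dyadic.\<close>

locale full_scaled_space = scaled_space M d c n for M :: "'a set" and d c n +
  assumes card_carrier: "card M = 2 ^ n"
begin

text \<open>The induction runs downwards from the whole space: if a ball of radius \<open>c\<^sub>j\<^sub>+\<^sub>1\<close> has only \<open>2\<^sup>j\<^sup>+\<^sup>1\<close> points,
there is no room for more than \<open>2\<^sup>j\<close> points in either of the two disjoint balls of radius \<open>c\<^sub>j\<close> in it.\<close>

lemma card_mcball: "\<lbrakk>j \<le> n; x \<in> M\<rbrakk> \<Longrightarrow> card (mcball x (c j)) = 2 ^ j"
proof (induction arbitrary: x rule: inc_induct)
  case base
  have "card (mcball x (c n)) \<le> card M"
    using finite_carrier mcball_subset_mspace card_mono by blast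
  then show ?case using card_mcball_ge[OF base, of n] card_carrier by simp
next
  case (step j)
  obtain y where y: "y \<in> M" "d x y = c (Suc j)" using scale_realised[of x "Suc j"] step by auto
  have "Suc j \<le> n" using step by simp
  note two = two_balls_subset[OF this step.prems y]
  have "card (mcball x (c j)) + card (mcball y (c j)) = card (mcball x (c j) \<union> mcball y (c j))"
    using two(2) finite_mcball card_Un_disjoint by metis
  also have "\<dots> \<le> card (mcball x (c (Suc j)))" using two(1) finite_mcball card_mono by blast
  also have "\<dots> = 2 ^ Suc j" using step by blast
  finally show ?case using card_mcball_ge[of x j] card_mcball_ge[of y j] y step by simp
qed

lemma mcball_Suc:
  assumes "Suc j \<le> n" "x \<in> M" "y \<in> M" "d x y = c (Suc j)"
  shows "mcball x (c (Suc j)) = mcball x (c j) \<union> mcball y (c j)"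
proof -
  note two = two_balls_subset[OF assms]
  have "card (mcball x (c j) \<union> mcball y (c j)) = card (mcball x (c j)) + card (mcball y (c j))"
    using two(2) finite_mcball card_Un_disjoint by metis
  also have "\<dots> = card (mcball x (c (Suc j)))" using card_mcball assms by simp
  finally show ?thesis using card_subset_eq[OF finite_mcball two(1)] by simp
qed

lemma mcball_top: "x \<in> M \<Longrightarrow> mcball x (c n) = M"
  using card_subset_eq[OF finite_carrier mcball_subset_mspace] card_mcball card_carrier by simp

text \<open>A point that enters when the radius grows from \<open>c\<^sub>j\<close> to \<open>c\<^sub>j\<^sub>+\<^sub>1\<close> lies in the other half, and points of
different halves have distance exactly \<open>c\<^sub>j\<^sub>+\<^sub>1\<close> by the isosceles property.\<close>

lemma dist_in_scale_of_mem_mcball: "\<lbrakk>x \<in> M; y \<in> mcball x (c j); j \<le> n\<rbrakk> \<Longrightarrow> \<exists>i\<le>n. d x y = c i"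
proof (induction j)
  case 0
  then have "y = x" using mcball_zero by blast
  then have "d x y = c 0" using scale_zero 0 by simp
  then show ?case by blast
next
  case (Suc j)
  obtain q where q: "q \<in> M" "d x q = c (Suc j)" using scale_realised Suc.prems by blast
  show ?case
  proof (cases "y \<in> mcball x (c j)")
    case True
    then show ?thesis using Suc by simp
  next
    case False
    then have "y \<in> mcball q (c j)" using mcball_Suc[OF Suc.prems(3,1) q] Suc.prems(2) by blast
    moreover have "c j < c (Suc j)" using scale_less Suc.prems by simp
    moreover have "y \<in> M" "d x y \<le> c (Suc j)" using Suc.prems(2) by auto
    ultimately have "d x y = c (Suc j)"
      using ultrametric[of x q y] q Suc.prems(1) commute[of y q] by (auto simp: in_mcball)
    then show ?thesis using Suc.prems by blast
  qed
qed

sublocale dyadic_space M d c n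
proof
  fix x y assume "x \<in> M" "y \<in> M"
  then show "\<exists>j\<le>n. d x y = c j" using dist_in_scale_of_mem_mcball mcball_top by blast
next
  fix x y z j
  assume xyz: "x \<in> M" "y \<in> M" "z \<in> M" and "0 < j" "j \<le> n" and d: "d x y = c j" "d x z = c j"
  then obtain i where j: "j = Suc i" "Suc i \<le> n" by (cases j) auto
  have less: "c i < c j" using scale_less j by simp
  have "z \<in> mcball x (c j)" "z \<notin> mcball x (c i)" using xyz d less by auto
  then have "z \<in> mcball y (c i)" using mcball_Suc[OF j(2) xyz(1,2)] d j by auto
  then show "d y z < c j" using less by (simp add: in_mcball)
qed

end

lemma (in ultrametric_space) finite_distance_set: "finite M \<Longrightarrow> finite (distance_set M d)"
proof -
  assume "finite M"
  moreover have "distance_set M d = (\<lambda>(x, y). d x y) ` (M \<times> M)" by (auto simp: distance_set_def)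
  ultimately show ?thesis by simp
qed

text \<open>The scale is the increasing enumeration of the center of distances.\<close>

lemma dyadic_of_MCD:
  assumes "MCD_space X d"
  shows "\<exists>c n. dyadic_space X d c n"
proof -
  interpret ultrametric_space X d using assms by (simp add: MCD_space_def)
  let ?C = "center_of_distances X d"
  define n where "n = card ?C - 1"
  define c where "c = (\<lambda>j. sorted_list_of_set ?C ! j)"
  have fX: "finite X" and cX: "card X = 2 ^ n" using assms by (auto simp: MCD_space_def n_def)
  have fC: "finite ?C" using finite_distance_set[OF fX] by (simp add: center_of_distances_def)
  have zero: "0 \<in> ?C" using carrier_nonempty
    by (auto simp: center_of_distances_def distance_set_def) (metis mdist_zero)+
  then have "card ?C \<noteq> 0" using fC by auto
  then have len: "length (sorted_list_of_set ?C) = Suc n" by (simp add: n_def)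
  have less: "c i < c j" if "i < j" "j \<le> n" for i j
    using sorted_wrt_nth_less[OF strict_sorted_list_of_set[of ?C] that(1)] that(2) len
    by (simp add: c_def)
  have mem: "c j \<in> ?C" if "j \<le> n" for j
    using nth_mem[of j "sorted_list_of_set ?C"] len that fC by (simp add: c_def)
  obtain i where "i \<le> n" "c i = 0"
    using zero fC len in_set_conv_nth[of 0 "sorted_list_of_set ?C"] by (auto simp: c_def less_Suc_eq_le)
  moreover have "0 \<le> c 0" using mem[of 0] by (auto simp: center_of_distances_def distance_set_def)
  ultimately have c0: "c 0 = 0" using less[of 0 i] by (cases i) auto
  interpret full_scaled_space X d c n
  proof
    fix x j assume "x \<in> X" "j \<le> n"
    then show "\<exists>y\<in>X. d x y = c j" using mem by (auto simp: center_of_distances_def)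
  qed (use fX cX c0 less in auto)
  show ?thesis using dyadic_space_axioms by blast
qed

section \<open>The representing tree of a dyadic space\<close>

context dyadic_space
begin

lemma dist_le_Suc:
  assumes "Suc j \<le> n" "x \<in> M" "y \<in> M"
  shows "d x y \<le> c (Suc j) \<longleftrightarrow> d x y \<le> c j \<or> d x y = c (Suc j)"
proof -
  obtain i where "i \<le> n" "d x y = c i" using dist_in_scale assms by blast
  then show ?thesis using assms(1) scale_le_iff scale_eq_iff by auto
qed

lemma mcball_Suc:
  assumes "Suc j \<le> n" "x \<in> M" "y \<in> M" "d x y = c (Suc j)"
  shows "mcball x (c (Suc j)) = mcball x (c j) \<union> mcball y (c j)"
proof
  show "mcball x (c j) \<union> mcball y (c j) \<subseteq> mcball x (c (Suc j))" by (rule two_balls_subset[OF assms])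
  show "mcball x (c (Suc j)) \<subseteq> mcball x (c j) \<union> mcball y (c j)"
  proof
    fix z assume z: "z \<in> mcball x (c (Suc j))"
    then have zM: "z \<in> M" by simp
    have "d y z \<le> c j" if "d x z = c (Suc j)"
      using no_equilateral[OF assms(2,3) zM _ assms(1,4) that] dist_le_Suc[OF assms(1,3) zM] by simp
    then show "z \<in> mcball x (c j) \<union> mcball y (c j)"
      using z zM dist_le_Suc[OF assms(1,2) zM] assms by auto
  qed
qed

lemma mcball_top: "x \<in> M \<Longrightarrow> mcball x (c n) = M"
proof -
  assume x: "x \<in> M"
  have "d x y \<le> c n" if "y \<in> M" for y
    using dist_in_scale[OF x that] scale_le_iff by auto
  then show ?thesis using x by auto
qed

lemma card_mcball: "\<lbrakk>x \<in> M; j \<le> n\<rbrakk> \<Longrightarrow> card (mcball x (c j)) = 2 ^ j"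
proof (induction j arbitrary: x)
  case 0
  then show ?case by (simp add: mcball_zero)
next
  case (Suc j)
  obtain y where y: "y \<in> M" "d x y = c (Suc j)" using scale_realised Suc.prems by blast
  have "card (mcball x (c (Suc j))) = card (mcball x (c j)) + card (mcball y (c j))"
    using mcball_Suc two_balls_subset(2) Suc.prems y finite_mcball card_Un_disjoint by metis
  then show ?case using Suc y by simp
qed

lemma center_eq: "center_of_distances M d = c ` {..n}"
proof
  show "center_of_distances M d \<subseteq> c ` {..n}"
    using dist_in_scale by (fastforce simp: center_of_distances_def distance_set_def)
  obtain p where p: "p \<in> M" using carrier_nonempty by blast
  show "c ` {..n} \<subseteq> center_of_distances M d"
  proof
    fix t assume "t \<in> c ` {..n}"
    then have real: "\<exists>y\<in>M. d x y = t" if "x \<in> M" for x using scale_realised that by auto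
    then have "t \<in> distance_set M d" using p by (force simp: distance_set_def)
    with real show "t \<in> center_of_distances M d" by (simp add: center_of_distances_def)
  qed
qed

lemma MCD_space: "MCD_space M d"
proof -
  have "inj_on c {..n}" using scale_eq_iff by (auto simp: inj_on_def)
  then have "card (center_of_distances M d) = Suc n" by (simp add: center_eq card_image)
  moreover obtain p where "p \<in> M" using carrier_nonempty by blast
  then have "card M = 2 ^ n" using card_mcball[of p n] mcball_top by simp
  ultimately show ?thesis
    using ultrametric_space_axioms finite_carrier by (simp add: MCD_space_def)
qed

lemma mdiam_mcball:
  assumes "x \<in> M" "j \<le> n"
  shows "mdiam d (mcball x (c j)) = c j"
  unfolding mdiam_def
proof (rule cSup_eq_maximum)
  obtain y where "y \<in> M" "d x y = c j" using scale_realised assms by blast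
  then show "c j \<in> distance_set (mcball x (c j)) d"
    using assms centre_mem[OF assms] unfolding distance_set_def by force
next
  fix t assume "t \<in> distance_set (mcball x (c j)) d"
  then obtain u v where uv: "u \<in> mcball x (c j)" "v \<in> mcball x (c j)" "t = d u v"
    by (auto simp: distance_set_def)
  then have "v \<in> mcball u (c j)" using mcball_eq_of_mem by blast
  then show "t \<le> c j" using uv by simp
qed

lemma mcball_eq_iff:
  assumes "x \<in> M" "y \<in> M" "i \<le> n" "j \<le> n"
  shows "mcball x (c i) = mcball y (c j) \<longleftrightarrow> i = j \<and> d x y \<le> c j"
proof
  assume eq: "mcball x (c i) = mcball y (c j)"
  then have "c i = c j" using mdiam_mcball assms by metis
  then have "i = j" using scale_eq_iff assms by simp
  moreover have "y \<in> mcball x (c i)" using eq centre_mem assms by simp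
  ultimately show "i = j \<and> d x y \<le> c j" by simp
next
  assume "i = j \<and> d x y \<le> c j"
  then show "mcball x (c i) = mcball y (c j)"
    using mcball_eq_of_mem[of y x "c j"] assms by (simp add: in_mcball)
qed

lemma not_splits_mcball_zero: "x \<in> M \<Longrightarrow> \<not> splits_into d (mcball x (c 0)) B"
  using mdiam_mcball[of x 0] scale_zero by (simp add: splits_into_def)

text \<open>Two points of a ball of diameter \<open>c\<^sub>j\<^sub>+\<^sub>1\<close> are not adjacent in its diametrical graph iff their distance
is at most \<open>c\<^sub>j\<close>, since no distance lies strictly between. So the part that contains \<open>y\<close> must be the
ball of radius \<open>c\<^sub>j\<close> around \<open>y\<close>, and conversely these balls do form a multipartition.\<close>

lemma splits_mcball_Suc_iff:
  assumes x: "x \<in> M" and j: "Suc j \<le> n"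
  shows "splits_into d (mcball x (c (Suc j))) B \<longleftrightarrow>
           (\<exists>y\<in>mcball x (c (Suc j)). B = mcball y (c j))"
proof -
  let ?A = "mcball x (c (Suc j))"
  have less: "c j < c (Suc j)" using scale_less j by simp
  have jn: "j \<le> n" using j by simp
  have AM: "u \<in> M" if "u \<in> ?A" for u using that by simp
  have diam: "mdiam d ?A = c (Suc j)" using mdiam_mcball x j by blast
  have pos: "0 < mdiam d ?A" using diam less scale_nonneg[OF jn] by simp
  have arc: "(u, v) \<in> parcs (diametrical_graph d ?A) \<longleftrightarrow> v \<notin> mcball u (c j)"
    if "u \<in> ?A" "v \<in> ?A" for u v
  proof -
    have "v \<in> mcball u (c (Suc j))" using that mcball_eq_of_mem by blast
    then have "d u v \<le> c (Suc j)" by simp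
    then have "d u v = c (Suc j) \<longleftrightarrow> \<not> d u v \<le> c j"
      using dist_le_Suc[OF j AM[OF that(1)] AM[OF that(2)]] less by auto
    then show ?thesis
      using that AM[OF that(1)] AM[OF that(2)] by (simp add: diametrical_graph_def diam)
  qed
  have sub: "mcball u (c j) \<subseteq> ?A" if "u \<in> ?A" for u
    using mcball_eq_of_mem[OF that] mcball_subset_concentric[of "c j" "c (Suc j)" u] less by simp
  show ?thesis
  proof
    assume "splits_into d ?A B"
    then obtain P where P: "complete_multipartite_with (diametrical_graph d ?A) P" "B \<in> P"
      by (auto simp: splits_into_def)
    then have part: "partition_on ?A P"
      and arcP: "\<And>u v. u \<in> ?A \<Longrightarrow> v \<in> ?A \<Longrightarrow>
        (u, v) \<in> parcs (diametrical_graph d ?A) \<longleftrightarrow> \<not> (\<exists>B\<in>P. u \<in> B \<and> v \<in> B)"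
      by (auto simp: complete_multipartite_with_def diametrical_graph_def)
    obtain y where y: "y \<in> B" using part P(2) by (metis partition_onD3 ex_in_conv)
    have BA: "B \<subseteq> ?A" using part P(2) by (auto simp: partition_on_def)
    then have yA: "y \<in> ?A" using y by (rule subsetD)
    have uniq: "B' = B" if "B' \<in> P" "y \<in> B'" for B'
      using part that P(2) y by (auto simp: partition_on_def disjoint_def)
    have "z \<in> B \<longleftrightarrow> z \<in> mcball y (c j)" for z
    proof (cases "z \<in> ?A")
      case True
      then have "z \<in> mcball y (c j) \<longleftrightarrow> (\<exists>B'\<in>P. y \<in> B' \<and> z \<in> B')"
        using arc[OF yA True] arcP[OF yA True] by blast
      then show ?thesis using uniq P(2) y by blast
    next
      case False
      then show ?thesis using BA sub[OF yA] by (meson subsetD)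
    qed
    then have "B = mcball y (c j)" by (rule set_eqI)
    then show "\<exists>y\<in>?A. B = mcball y (c j)" using yA by (rule rev_bexI[rotated])
  next
    assume "\<exists>y\<in>?A. B = mcball y (c j)"
    moreover define P where "P = (\<lambda>y. mcball y (c j)) ` ?A"
    ultimately have BP: "B \<in> P" by blast
    have mem: "u \<in> mcball u (c j)" if "u \<in> ?A" for u using centre_mem AM[OF that] jn by blast
    have same: "mcball w (c j) = mcball u (c j)" if "u \<in> mcball w (c j)" for u w
      using mcball_eq_of_mem[OF that] by simp
    have "partition_on ?A P"
      unfolding P_def
    proof (rule partition_onI)
      show "\<Union> ((\<lambda>y. mcball y (c j)) ` ?A) = ?A" using sub mem by blast
      show "{} \<notin> (\<lambda>y. mcball y (c j)) ` ?A" using mem by blast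
      show "disjnt p q" if "p \<in> (\<lambda>y. mcball y (c j)) ` ?A" "q \<in> (\<lambda>y. mcball y (c j)) ` ?A" "p \<noteq> q" for p q
        using that same unfolding disjnt_def by blast
    qed
    moreover have "2 \<le> card P"
    proof -
      obtain y where y: "y \<in> M" "d x y = c (Suc j)" using scale_realised x j by blast
      have "mcball x (c j) \<noteq> mcball y (c j)"
        using mcball_eq_iff[OF x y(1) jn jn] y less by simp
      moreover have "x \<in> ?A" "y \<in> ?A" using x y centre_mem j by auto
      then have "{mcball x (c j), mcball y (c j)} \<subseteq> P" by (auto simp: P_def)
      moreover have "finite P" unfolding P_def using finite_mcball by blast
      ultimately show ?thesis using card_mono[of P "{mcball x (c j), mcball y (c j)}"] by simp
    qed
    moreover have "v \<in> mcball u (c j) \<longleftrightarrow> (\<exists>B\<in>P. u \<in> B \<and> v \<in> B)" if "u \<in> ?A" for u v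
      using that mem same unfolding P_def by blast
    then have "\<forall>u\<in>?A. \<forall>v\<in>?A. (u, v) \<in> parcs (diametrical_graph d ?A)
        \<longleftrightarrow> \<not> (\<exists>B\<in>P. u \<in> B \<and> v \<in> B)"
      by (intro ballI) (simp only: arc not_not)
    moreover have "pverts (diametrical_graph d ?A) = ?A" by (simp add: diametrical_graph_def)
    ultimately have "complete_multipartite_with (diametrical_graph d ?A) P"
      unfolding complete_multipartite_with_def by presburger
    then show "splits_into d ?A B" using pos BP by (auto simp: splits_into_def)
  qed
qed

lemma rep_nodes_eq: "rep_nodes d M = {mcball x (c j) | x j. x \<in> M \<and> j \<le> n}"
proof
  obtain p where p: "p \<in> M" using carrier_nonempty by blast
  show "rep_nodes d M \<subseteq> {mcball x (c j) | x j. x \<in> M \<and> j \<le> n}"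
  proof
    fix A assume "A \<in> rep_nodes d M"
    then show "A \<in> {mcball x (c j) | x j. x \<in> M \<and> j \<le> n}"
    proof induction
      case root
      then show ?case using mcball_top p by blast
    next
      case (split A B)
      then obtain x j where A: "A = mcball x (c j)" "x \<in> M" "j \<le> n" by blast
      then obtain i where j: "j = Suc i"
        using split not_splits_mcball_zero by (cases j) auto
      then obtain y where "y \<in> M" "B = mcball y (c i)"
        using splits_mcball_Suc_iff A split by auto
      then show ?case using A j Suc_leD by blast
    qed
  qed
  have "mcball x (c j) \<in> rep_nodes d M" if "j \<le> n" "x \<in> M" for x j
    using that(1)
  proof (induction rule: inc_induct)
    case base
    then show ?case using mcball_top[OF that(2)] rep_nodes.root by metis
  next
    case (step i)
    then have "Suc i \<le> n" by simp
    then have "splits_into d (mcball x (c (Suc i))) (mcball x (c i))"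
      using splits_mcball_Suc_iff[OF that(2)] centre_mem[OF that(2)] by blast
    then show ?case using step rep_nodes.split by metis
  qed
  then show "{mcball x (c j) | x j. x \<in> M \<and> j \<le> n} \<subseteq> rep_nodes d M" by blast
qed

text \<open>Recovers \<open>j\<close> from the node \<open>mcball x (c j)\<close>; the center \<open>x\<close> is not determined by the node.\<close>

definition radius_index :: "'a set \<Rightarrow> nat" where
  "radius_index A = (THE j. j \<le> n \<and> mdiam d A = c j)"

lemma radius_index_mcball: "\<lbrakk>x \<in> M; j \<le> n\<rbrakk> \<Longrightarrow> radius_index (mcball x (c j)) = j"
  unfolding radius_index_def using mdiam_mcball scale_eq_iff by (intro the_equality) auto

lemma splits_iff:
  assumes "x \<in> M" "y \<in> M" "i \<le> n" "j \<le> n"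
  shows "splits_into d (mcball x (c i)) (mcball y (c j)) \<longleftrightarrow> i = Suc j \<and> d x y \<le> c i"
proof (cases i)
  case 0
  then show ?thesis using not_splits_mcball_zero assms by simp
next
  case (Suc k)
  have kn: "k \<le> n" using assms Suc by simp
  have ck: "c k \<le> c i" using scale_le_iff assms Suc by simp
  show ?thesis
  proof
    assume "splits_into d (mcball x (c i)) (mcball y (c j))"
    then obtain z where z: "z \<in> mcball x (c i)" "mcball y (c j) = mcball z (c k)"
      using splits_mcball_Suc_iff[OF assms(1), of k] assms Suc by auto
    then have "j = k" "d y z \<le> c k" using mcball_eq_iff[OF assms(2) _ assms(4) kn] by auto
    then show "i = Suc j \<and> d x y \<le> c i"
      using ultrametric[of x y z] commute[of y z] z assms Suc ck by auto
  next
    assume "i = Suc j \<and> d x y \<le> c i"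
    then show "splits_into d (mcball x (c i)) (mcball y (c j))"
      using splits_mcball_Suc_iff[OF assms(1), of j] assms by auto
  qed
qed

lemma rep_tree_hierarchy:
  "hierarchy (rep_tree M d) M (\<lambda>A. n - radius_index A) (splits_into d)"
proof
  obtain p where p: "p \<in> M" using carrier_nonempty by blast
  then have top: "M = mcball p (c n)" using mcball_top by simp
  show "M \<in> pverts (rep_tree M d)" by (simp add: rep_tree_def rep_nodes.root)
  have "radius_index M = n" using radius_index_mcball[OF p, of n] top by simp
  then show "n - radius_index M = 0" by simp
next
  fix A B assume "A \<in> pverts (rep_tree M d)" "B \<in> pverts (rep_tree M d)"
  then show "(A, B) \<in> parcs (rep_tree M d) \<longleftrightarrow> splits_into d A B \<or> splits_into d B A"
    by (simp add: rep_tree_def)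
next
  fix A B assume "A \<in> pverts (rep_tree M d)" "B \<in> pverts (rep_tree M d)" and s: "splits_into d A B"
  then obtain x i y j where AB: "A = mcball x (c i)" "x \<in> M" "i \<le> n" "B = mcball y (c j)" "y \<in> M" "j \<le> n"
    by (auto simp: rep_tree_def rep_nodes_eq)
  then have "i = Suc j" using s splits_iff by simp
  then show "n - radius_index B = Suc (n - radius_index A)"
    using AB radius_index_mcball by simp
next
  fix A A' B
  assume "A \<in> pverts (rep_tree M d)" "A' \<in> pverts (rep_tree M d)" "B \<in> pverts (rep_tree M d)"
    and s: "splits_into d A B" "splits_into d A' B"
  then obtain x i x' i' y j where AB: "A = mcball x (c i)" "x \<in> M" "i \<le> n"
    "A' = mcball x' (c i')" "x' \<in> M" "i' \<le> n" "B = mcball y (c j)" "y \<in> M" "j \<le> n"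
    by (auto simp: rep_tree_def rep_nodes_eq)
  then have "i = Suc j" "i' = Suc j" "y \<in> mcball x (c i)" "y \<in> mcball x' (c i')"
    using s splits_iff by auto
  then show "A = A'" using mcball_eq_of_mem AB by metis
next
  fix B assume "B \<in> pverts (rep_tree M d)" "B \<noteq> M"
  then obtain y j where B: "B = mcball y (c j)" "y \<in> M" "j \<le> n" "mcball y (c j) \<noteq> M"
    by (auto simp: rep_tree_def rep_nodes_eq)
  then have j: "Suc j \<le> n" using mcball_top by (metis Suc_leI le_neq_implies_less)
  then have "splits_into d (mcball y (c (Suc j))) B"
    using B splits_iff[of y y "Suc j" j] scale_nonneg[OF j] by simp
  moreover have "mcball y (c (Suc j)) \<in> pverts (rep_tree M d)"
    using B j by (auto simp: rep_tree_def rep_nodes_eq)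
  ultimately show "\<exists>A\<in>pverts (rep_tree M d). splits_into d A B" by blast
qed

lemma two_children:
  assumes "x \<in> M" "Suc j \<le> n"
  shows "card {B \<in> rep_nodes d M. splits_into d (mcball x (c (Suc j))) B} = 2"
proof -
  obtain y where y: "y \<in> M" "d x y = c (Suc j)" using scale_realised assms by blast
  have jn: "j \<le> n" using assms by simp
  have less: "c j < c (Suc j)" using scale_less assms by simp
  have "mcball z (c j) \<in> rep_nodes d M" if "z \<in> M" for z
    using that jn by (auto simp: rep_nodes_eq)
  then have "{B \<in> rep_nodes d M. splits_into d (mcball x (c (Suc j))) B}
      = (\<lambda>z. mcball z (c j)) ` mcball x (c (Suc j))"
    using splits_mcball_Suc_iff[OF assms] by auto
  also have "\<dots> = (\<lambda>z. mcball z (c j)) ` (mcball x (c j) \<union> mcball y (c j))"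
    using mcball_Suc[OF assms(2,1) y] by simp
  also have "\<dots> = {mcball x (c j), mcball y (c j)}"
    using mcball_eq_of_mem centre_mem[OF assms(1) jn] centre_mem[OF y(1) jn] by blast
  finally show ?thesis
    using mcball_eq_iff[OF assms(1) y(1) jn jn] y less by simp
qed

end

section \<open>The ultrametric space of leaves of a perfect binary tree\<close>

locale perfect_tree = hierarchy G r lvl child
  for G :: "'v pair_pre_digraph" and r lvl child +
  fixes n :: nat and l :: "'v \<Rightarrow> real"
  assumes lvl_le: "v \<in> pverts G \<Longrightarrow> lvl v \<le> n"
    and card_children: "\<lbrakk>v \<in> pverts G; lvl v < n\<rbrakk> \<Longrightarrow> card {w \<in> pverts G. child v w} = 2"
    and label_of_lvl: "\<lbrakk>v \<in> pverts G; w \<in> pverts G; lvl v = lvl w\<rbrakk> \<Longrightarrow> l v = l w"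
    and label_child: "\<lbrakk>v \<in> pverts G; w \<in> pverts G; child v w\<rbrakk> \<Longrightarrow> l w < l v"
    and label_leaf: "\<lbrakk>v \<in> pverts G; lvl v = n\<rbrakk> \<Longrightarrow> l v = 0"
begin

definition parent :: "'v \<Rightarrow> 'v" where
  "parent v = (THE u. u \<in> pverts G \<and> child u v)"

lemma parent_eqI: "\<lbrakk>u \<in> pverts G; v \<in> pverts G; child u v\<rbrakk> \<Longrightarrow> parent v = u"
  unfolding parent_def using parent_unique by blast

lemma parent:
  assumes "v \<in> pverts G" "lvl v = Suc k"
  shows "parent v \<in> pverts G" "child (parent v) v" "lvl (parent v) = k"
proof -
  have "v \<noteq> r" using assms lvl_root by auto
  then obtain u where u: "u \<in> pverts G" "child u v" using parent_exists assms by blast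
  then have "parent v = u" using parent_eqI assms by blast
  then show "parent v \<in> pverts G" "child (parent v) v" "lvl (parent v) = k"
    using u lvl_child[OF u(1) assms(1) u(2)] assms by auto
qed

lemma lvl_zero_iff: "v \<in> pverts G \<Longrightarrow> lvl v = 0 \<longleftrightarrow> v = r"
  using lvl_root parent_exists[of v] lvl_child[of _ v] by fastforce

text \<open>The common label of the vertices at height \<open>j\<close> above the leaves, which becomes the scale of the leaf
space. Well-defined by \<open>label_of_lvl\<close>.\<close>

definition height_label :: "nat \<Rightarrow> real" where
  "height_label j = l (SOME v. v \<in> pverts G \<and> lvl v = n - j)"

lemma height_label: "\<lbrakk>v \<in> pverts G; lvl v = n - j\<rbrakk> \<Longrightarrow> height_label j = l v"
  unfolding height_label_def
  by (rule someI2[of "\<lambda>v. v \<in> pverts G \<and> lvl v = n - j" v]) (auto intro: label_of_lvl)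

end

text \<open>The points of the space are indexed by \<open>leaf_of\<close> instead of being the leaves themselves, so that the
carrier may have any type with enough elements.\<close>

locale leaf_space = perfect_tree G r lvl child n l
  for G :: "'v pair_pre_digraph" and r lvl child n l +
  fixes X :: "'b set" and leaf_of :: "'b \<Rightarrow> 'v"
  assumes finite_X: "finite X"
    and leaf_of: "bij_betw leaf_of X {v \<in> pverts G. lvl v = n}"
begin

definition anc :: "nat \<Rightarrow> 'b \<Rightarrow> 'v" where
  "anc j x = (parent ^^ j) (leaf_of x)"

lemma anc_Suc: "anc (Suc j) x = parent (anc j x)"
  by (simp add: anc_def)

lemma anc: "\<lbrakk>x \<in> X; j \<le> n\<rbrakk> \<Longrightarrow> anc j x \<in> pverts G \<and> lvl (anc j x) = n - j"
proof (induction j)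
  case 0
  then show ?case using leaf_of by (auto simp: anc_def bij_betw_def)
next
  case (Suc j)
  then show ?case
    using parent[of "anc j x" "n - Suc j"] by (simp add: anc_Suc Suc_diff_Suc)
qed

lemmas anc_in = anc[THEN conjunct1] and lvl_anc = anc[THEN conjunct2]

lemma anc_top: "x \<in> X \<Longrightarrow> anc n x = r"
  using anc[of x n] lvl_zero_iff by auto

lemma anc_mono: "anc j x = anc j y" if "anc i x = anc i y" "i \<le> j"
  using that(2,1) by (induction rule: dec_induct) (auto simp: anc_Suc)

lemma child_anc_Suc: "\<lbrakk>x \<in> X; Suc j \<le> n\<rbrakk> \<Longrightarrow> child (anc (Suc j) x) (anc j x)"
  using anc[of x j] parent(2)[of "anc j x" "n - Suc j"] by (simp add: anc_Suc Suc_diff_Suc)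

text \<open>Every vertex has a leaf below it, because all vertices of level less than \<open>n\<close> have children.\<close>

lemma anc_surj: "\<lbrakk>v \<in> pverts G; lvl v = n - j; j \<le> n\<rbrakk> \<Longrightarrow> \<exists>x\<in>X. anc j x = v"
proof (induction j arbitrary: v)
  case 0
  then have "v \<in> leaf_of ` X" using leaf_of by (simp add: bij_betw_def)
  then show ?case by (auto simp: anc_def)
next
  case (Suc j)
  have "card {w \<in> pverts G. child v w} = 2" using card_children Suc.prems by simp
  then have "{w \<in> pverts G. child v w} \<noteq> {}" by force
  then obtain w where w: "w \<in> pverts G" "child v w" by blast
  then have "lvl w = n - j" using lvl_child[of v w] Suc.prems by simp
  then obtain x where "x \<in> X" "anc j x = w" using Suc.IH w Suc.prems by force
  then show ?case using parent_eqI[of v w] w Suc.prems by (auto simp: anc_Suc)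
qed

lemma X_nonempty: "X \<noteq> {}"
  using anc_surj[of r n] root_in lvl_root by auto

lemma height_label_anc: "\<lbrakk>x \<in> X; j \<le> n\<rbrakk> \<Longrightarrow> l (anc j x) = height_label j"
  using height_label anc by metis

lemma height_label_zero: "height_label 0 = 0"
proof -
  obtain x where "x \<in> X" using X_nonempty by blast
  then show ?thesis using label_leaf[of "anc 0 x"] anc[of x 0] height_label_anc[of x 0] by simp
qed

lemma height_label_less: "height_label i < height_label j" if "i < j" "j \<le> n"
  using that
proof (induction rule: strict_inc_induct)
  case (base i)
  obtain x where "x \<in> X" using X_nonempty by blast
  then show ?case
    using label_child[of "anc (Suc i) x" "anc i x"] child_anc_Suc anc_in height_label_anc base
    by (metis Suc_leD)
next
  case (step i)
  obtain x where "x \<in> X" using X_nonempty by blast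
  then have "height_label i < height_label (Suc i)"
    using label_child[of "anc (Suc i) x" "anc i x"] child_anc_Suc[of x i] anc_in height_label_anc step
    by simp
  then show ?case using step by simp
qed

lemma height_label_le_iff:
  "\<lbrakk>i \<le> n; j \<le> n\<rbrakk> \<Longrightarrow> height_label i \<le> height_label j \<longleftrightarrow> i \<le> j"
  using height_label_less[of i j] height_label_less[of j i] by (cases i j rule: linorder_cases) auto

text \<open>The height of the lowest common ancestor.\<close>

definition meet_height :: "'b \<Rightarrow> 'b \<Rightarrow> nat" where
  "meet_height x y = (LEAST j. anc j x = anc j y)"

text \<open>The axioms of \<open>Metric_space\<close> demand symmetry and non-negativity on the whole type, whence the value
0 off the carrier.\<close>

definition leaf_dist :: "'b \<Rightarrow> 'b \<Rightarrow> real" where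
  "leaf_dist x y = (if x \<in> X \<and> y \<in> X then height_label (meet_height x y) else 0)"

lemma meet_height_le_iff:
  assumes "x \<in> X" "y \<in> X"
  shows "meet_height x y \<le> j \<longleftrightarrow> anc j x = anc j y"
proof
  have "anc (meet_height x y) x = anc (meet_height x y) y"
    unfolding meet_height_def by (rule LeastI[of _ n]) (simp add: anc_top assms)
  then show "meet_height x y \<le> j \<Longrightarrow> anc j x = anc j y" using anc_mono by blast
  show "anc j x = anc j y \<Longrightarrow> meet_height x y \<le> j" unfolding meet_height_def by (rule Least_le)
qed

lemma meet_height_le: "\<lbrakk>x \<in> X; y \<in> X\<rbrakk> \<Longrightarrow> meet_height x y \<le> n"
  by (simp add: meet_height_le_iff anc_top)

text \<open>Balls of the leaf space are sets of leaves with a common ancestor. The ultrametric inequality and the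
dyadic structure are read off from this.\<close>

lemma leaf_dist_le_iff:
  "\<lbrakk>x \<in> X; y \<in> X; j \<le> n\<rbrakk> \<Longrightarrow> leaf_dist x y \<le> height_label j \<longleftrightarrow> anc j x = anc j y"
  using height_label_le_iff[OF meet_height_le] meet_height_le_iff by (simp add: leaf_dist_def)

lemma leaf_dist_nonneg: "0 \<le> leaf_dist x y"
  using height_label_le_iff[of 0] meet_height_le height_label_zero by (simp add: leaf_dist_def)

lemma leaf_dist_commute: "leaf_dist x y = leaf_dist y x"
proof -
  have "(\<lambda>j. anc j x = anc j y) = (\<lambda>j. anc j y = anc j x)" by auto
  then show ?thesis by (simp add: leaf_dist_def meet_height_def)
qed

lemma leaf_dist_in_scale: "\<lbrakk>x \<in> X; y \<in> X\<rbrakk> \<Longrightarrow> \<exists>j\<le>n. leaf_dist x y = height_label j"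
  using meet_height_le by (auto simp: leaf_dist_def)

lemma leaf_dist_ultrametric:
  assumes "x \<in> X" "y \<in> X" "z \<in> X"
  shows "leaf_dist x y \<le> max (leaf_dist x z) (leaf_dist z y)"
proof -
  obtain i j where ij: "i \<le> n" "leaf_dist x z = height_label i" "j \<le> n" "leaf_dist z y = height_label j"
    using leaf_dist_in_scale assms by meson
  let ?k = "max i j"
  have "height_label ?k = max (height_label i) (height_label j)"
    using height_label_le_iff[of i j] height_label_le_iff[of j i] ij by (auto simp: max_def)
  moreover have "anc i x = anc i z" "anc j z = anc j y"
    using leaf_dist_le_iff[of x z i] leaf_dist_le_iff[of z y j] ij assms by auto
  then have "anc ?k x = anc ?k y" using anc_mono by (metis max.cobounded1 max.cobounded2)
  then have "leaf_dist x y \<le> height_label ?k" using leaf_dist_le_iff[of x y ?k] assms ij by simp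
  ultimately show ?thesis using ij by simp
qed

lemma leaf_dist_eq_SucI:
  assumes "x \<in> X" "y \<in> X" "Suc i \<le> n" "anc (Suc i) x = anc (Suc i) y" "anc i x \<noteq> anc i y"
  shows "leaf_dist x y = height_label (Suc i)"
proof -
  have "meet_height x y \<le> Suc i" "\<not> meet_height x y \<le> i"
    using assms by (simp_all add: meet_height_le_iff)
  then have "meet_height x y = Suc i" by simp
  then show ?thesis using assms by (simp add: leaf_dist_def)
qed

lemma leaf_dist_eq_SucD:
  assumes "x \<in> X" "y \<in> X" "Suc i \<le> n" "leaf_dist x y = height_label (Suc i)"
  shows "anc (Suc i) x = anc (Suc i) y" "anc i x \<noteq> anc i y"
proof -
  show "anc (Suc i) x = anc (Suc i) y" using leaf_dist_le_iff[of x y "Suc i"] assms by simp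
  show "anc i x \<noteq> anc i y"
    using leaf_dist_le_iff[of x y i] height_label_less[of i "Suc i"] assms by simp
qed

text \<open>Both dyadic axioms hold because inner vertices have exactly two children. Each leaf has a leaf at any
given positive height of meeting, below the other child of its ancestor at that height. Of three leaves with a
common ancestor, two lie below the same child.\<close>

sublocale dyadic_space X leaf_dist height_label n
proof
  show "X \<noteq> {}" by (rule X_nonempty)
  show "finite X" by (rule finite_X)
  show "height_label 0 = 0" by (rule height_label_zero)
  fix x y
  show "0 \<le> leaf_dist x y" by (rule leaf_dist_nonneg)
  show "leaf_dist x y = leaf_dist y x" by (rule leaf_dist_commute)
next
  fix x y assume xy: "x \<in> X" "y \<in> X"
  have "inj_on leaf_of X" using leaf_of by (simp add: bij_betw_def)
  then have "leaf_dist x y \<le> 0 \<longleftrightarrow> x = y"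
    using leaf_dist_le_iff[OF xy, of 0] xy by (simp add: height_label_zero anc_def inj_on_eq_iff)
  then show "leaf_dist x y = 0 \<longleftrightarrow> x = y" using leaf_dist_nonneg[of x y] by linarith
next
  fix x y z assume "x \<in> X" "y \<in> X" "z \<in> X"
  then show "leaf_dist x z \<le> leaf_dist x y + leaf_dist y z"
    using leaf_dist_ultrametric[of x z y] leaf_dist_nonneg[of x y] leaf_dist_nonneg[of y z] by linarith
next
  fix x y z assume "x \<in> X" "y \<in> X" "z \<in> X"
  then show "leaf_dist x y \<le> max (leaf_dist x z) (leaf_dist z y)" by (rule leaf_dist_ultrametric)
next
  fix i j assume "i < j" "j \<le> n"
  then show "height_label i < height_label j" by (rule height_label_less)
next
  fix x j assume x: "x \<in> X" and j: "j \<le> n"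
  show "\<exists>y\<in>X. leaf_dist x y = height_label j"
  proof (cases j)
    case 0
    have "leaf_dist x x \<le> height_label 0" using leaf_dist_le_iff[OF x x, of 0] by simp
    then have "leaf_dist x x = height_label 0"
      using leaf_dist_nonneg[of x x] height_label_zero by simp
    then show ?thesis using x 0 by blast
  next
    case (Suc i)
    let ?u = "anc (Suc i) x" and ?v = "anc i x"
    have u: "?u \<in> pverts G" "lvl ?u = n - Suc i" and v: "?v \<in> pverts G" "child ?u ?v"
      using anc child_anc_Suc x j Suc by auto
    have "card {w \<in> pverts G. child ?u w} = 2" using card_children u j Suc by simp
    \<comment> \<open>the other child of the ancestor of \<open>x\<close> at height \<open>j\<close>\<close>
    then have "\<not> {w \<in> pverts G. child ?u w} \<subseteq> {?v}"
      using card_mono[of "{?v}" "{w \<in> pverts G. child ?u w}"] by auto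
    then obtain w where w: "w \<in> pverts G" "child ?u w" "w \<noteq> ?v" by blast
    then have "lvl w = n - i" using lvl_child[of ?u w] u j Suc by simp
    then obtain y where y: "y \<in> X" "anc i y = w" using anc_surj[OF w(1), of i] j Suc by auto
    then have "anc (Suc i) y = ?u" using parent_eqI[of ?u w] u w by (simp add: anc_Suc[of i y])
    then have "leaf_dist x y = height_label j" using leaf_dist_eq_SucI[of x y i] x y w j Suc by simp
    then show ?thesis using y by blast
  qed
next
  fix x y assume "x \<in> X" "y \<in> X"
  then show "\<exists>j\<le>n. leaf_dist x y = height_label j" by (rule leaf_dist_in_scale)
next
  fix x y z j
  assume xyz: "x \<in> X" "y \<in> X" "z \<in> X" and "0 < j" and j: "j \<le> n"
    and d: "leaf_dist x y = height_label j" "leaf_dist x z = height_label j"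
  then obtain i where i: "j = Suc i" by (cases j) auto
  let ?u = "anc (Suc i) x"
  let ?C = "{w \<in> pverts G. child ?u w}"
  have y: "?u = anc (Suc i) y" "anc i x \<noteq> anc i y" and z: "?u = anc (Suc i) z" "anc i x \<noteq> anc i z"
    using leaf_dist_eq_SucD[OF xyz(1,2)] leaf_dist_eq_SucD[OF xyz(1,3)] d j i by auto
  have "child ?u (anc i x)" "child ?u (anc i y)" "child ?u (anc i z)"
    using child_anc_Suc[of x i] child_anc_Suc[of y i] child_anc_Suc[of z i] xyz y z j i by auto
  then have sub: "{anc i x, anc i y, anc i z} \<subseteq> ?C" using anc_in xyz j i by auto
  have c2: "card ?C = 2" using card_children anc[of x "Suc i"] xyz j i by simp
  then have "finite ?C" by (intro card_ge_0_finite) simp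
  then have "card {anc i x, anc i y, anc i z} \<le> 2" using card_mono[OF _ sub] c2 by simp
  then have "anc i y = anc i z" using y(2) z(2) by (auto simp: card_insert_if split: if_splits)
  then have "leaf_dist y z \<le> height_label i" using leaf_dist_le_iff[of y z i] xyz j i by simp
  then show "leaf_dist y z < height_label j" using height_label_less[of i j] i j by simp
qed

text \<open>The isomorphism from the tree to the representing tree of its leaf space.\<close>

definition leaves_below :: "'v \<Rightarrow> 'b set" where
  "leaves_below v = {x \<in> X. anc (n - lvl v) x = v}"

lemma leaves_below_anc:
  "\<lbrakk>x \<in> X; j \<le> n\<rbrakk> \<Longrightarrow> leaves_below (anc j x) = mcball x (height_label j)"
  using leaf_dist_le_iff[of x _ j] anc[of x j] by (auto simp: leaves_below_def in_mcball)

lemma vertex_anc: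
  assumes "v \<in> pverts G"
  obtains x j where "x \<in> X" "j \<le> n" "v = anc j x"
proof -
  obtain x where "x \<in> X" "anc (n - lvl v) x = v"
    using anc_surj[OF assms, of "n - lvl v"] lvl_le[OF assms] by auto
  then show thesis using that[of x "n - lvl v"] by simp
qed

lemma leaves_below_bij: "bij_betw leaves_below (pverts G) (rep_nodes leaf_dist X)"
proof (rule bij_betwI')
  fix u v assume "u \<in> pverts G" "v \<in> pverts G"
  then obtain x i y j where uv: "x \<in> X" "i \<le> n" "u = anc i x" "y \<in> X" "j \<le> n" "v = anc j y"
    by (metis vertex_anc)
  show "leaves_below u = leaves_below v \<longleftrightarrow> u = v"
  proof
    assume "leaves_below u = leaves_below v"
    then have "mcball x (height_label i) = mcball y (height_label j)"
      using leaves_below_anc uv by simp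
    then have "i = j \<and> leaf_dist x y \<le> height_label j"
      using mcball_eq_iff[of x y i j] uv by simp
    then show "u = v" using leaf_dist_le_iff[of x y j] uv by simp
  qed simp
next
  fix v assume "v \<in> pverts G"
  then obtain x j where xj: "x \<in> X" "j \<le> n" "v = anc j x" using vertex_anc by blast
  then have "leaves_below v = mcball x (height_label j)" using leaves_below_anc by simp
  with xj show "leaves_below v \<in> rep_nodes leaf_dist X" unfolding rep_nodes_eq by blast
next
  fix A assume "A \<in> rep_nodes leaf_dist X"
  then obtain x j where "x \<in> X" "j \<le> n" "A = mcball x (height_label j)"
    by (auto simp: rep_nodes_eq)
  then show "\<exists>v\<in>pverts G. A = leaves_below v" using leaves_below_anc anc_in by metis
qed

lemma splits_leaves_below_iff:
  assumes "u \<in> pverts G" "v \<in> pverts G"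
  shows "splits_into leaf_dist (leaves_below u) (leaves_below v) \<longleftrightarrow> child u v"
proof -
  obtain x i y j where uv: "x \<in> X" "i \<le> n" "u = anc i x" "y \<in> X" "j \<le> n" "v = anc j y"
    using assms by (metis vertex_anc)
  have "splits_into leaf_dist (leaves_below u) (leaves_below v) \<longleftrightarrow> i = Suc j \<and> anc i x = anc i y"
    using splits_iff[of x y i j] leaf_dist_le_iff[of x y i] uv by (simp add: leaves_below_anc)
  also have "\<dots> \<longleftrightarrow> child u v"
  proof
    assume "i = Suc j \<and> anc i x = anc i y"
    then have "u = anc (Suc j) y" "Suc j \<le> n" using uv by auto
    then show "child u v" using child_anc_Suc[of y j] uv by simp
  next
    assume c: "child u v"
    then have "n - j = Suc (n - i)" using lvl_child[OF assms] lvl_anc uv by simp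
    then have "i = Suc j" using uv by arith
    moreover have "anc (Suc j) y = u" using parent_eqI[OF assms c] uv by (simp add: anc_Suc)
    ultimately show "i = Suc j \<and> anc i x = anc i y" using uv by simp
  qed
  finally show ?thesis .
qed

lemma rep_tree_isomorphic:
  "labeled_tree_isomorphic (rep_tree X leaf_dist) X (mdiam leaf_dist) G r l"
proof -
  let ?F = "the_inv_into (pverts G) leaves_below"
  have inj: "inj_on leaves_below (pverts G)" using leaves_below_bij by (simp add: bij_betw_def)
  have img: "leaves_below ` pverts G = rep_nodes leaf_dist X"
    using leaves_below_bij by (simp add: bij_betw_def)
  have F: "?F (leaves_below v) = v" if "v \<in> pverts G" for v
    using the_inv_into_f_f[OF inj that] .
  have "bij_betw ?F (rep_nodes leaf_dist X) (pverts G)"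
    using bij_betw_the_inv_into[OF leaves_below_bij] .
  moreover have "(leaves_below u, leaves_below v) \<in> parcs (rep_tree X leaf_dist) \<longleftrightarrow> (u, v) \<in> parcs G"
    if "u \<in> pverts G" "v \<in> pverts G" for u v
    using arc_iff that splits_leaves_below_iff img by (auto simp: rep_tree_def)
  then have "\<forall>A\<in>rep_nodes leaf_dist X. \<forall>B\<in>rep_nodes leaf_dist X.
      (A, B) \<in> parcs (rep_tree X leaf_dist) \<longleftrightarrow> (?F A, ?F B) \<in> parcs G"
    unfolding img[symmetric] using F by simp
  moreover have "leaves_below r = X" using root_in lvl_root anc_top by (auto simp: leaves_below_def)
  then have "?F X = r" using F root_in by metis
  moreover have "l v = mdiam leaf_dist (leaves_below v)" if v: "v \<in> pverts G" for v
  proof -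
    obtain x j where "x \<in> X" "j \<le> n" "v = anc j x" using vertex_anc[OF v] .
    then show ?thesis using mdiam_mcball height_label_anc leaves_below_anc by simp
  qed
  then have "\<forall>A\<in>rep_nodes leaf_dist X. l (?F A) = mdiam leaf_dist A"
    unfolding img[symmetric] using F by simp
  ultimately show ?thesis
    unfolding labeled_tree_isomorphic_def by (intro exI[of _ ?F]) (simp add: rep_tree_def)
qed

end

section \<open>The characterisation\<close>

lemma finite_pverts: "rooted_tree G r \<Longrightarrow> finite (pverts G)"
  by (simp add: rooted_tree_def undirected_tree_def pair_graph_def pair_digraph_def
      pair_fin_digraph_def pair_fin_digraph_axioms_def)

lemma leaf_iff_no_successor:
  assumes "rooted_tree G r" and "v \<in> pverts G"
  shows "v \<in> tree_leaves G r \<longleftrightarrow> (\<forall>w\<in>pverts G. \<not> direct_successor G r w v)"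
  using assms finite_pverts[OF assms(1)]
  by (auto simp: tree_leaves_def tree_out_degree_eq_card_successors)

text \<open>With \<open>n\<close> the largest level, a vertex of level \<open>n\<close> cannot have a child and so is a leaf; as
all leaves have the same level, the vertices of level less than \<open>n\<close> are exactly the inner ones. The
leaf space of this tree is the required MCD-space.\<close>

lemma MCD_of_perfect_labeled_tree:
  fixes G :: "'v pair_pre_digraph" and r :: 'v and l :: "'v \<Rightarrow> real"
  assumes tree: "rooted_tree G r"
    and perfect: "perfect_binary_tree G r"
    and leaf: "\<forall>v\<in>tree_leaves G r. l v = 0"
    and level: "\<forall>w\<in>pverts G. \<forall>x\<in>pverts G. lev G r w = lev G r x \<longleftrightarrow> l w = l x"
    and less: "\<forall>y\<in>pverts G. \<forall>z\<in>pverts G. direct_successor G r z y \<longrightarrow> l z < l y"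
  shows "\<exists>(X :: 'b::infinite set) d. MCD_space X d \<and>
           labeled_tree_isomorphic (rep_tree X d) X (mdiam d) G r l"
proof -
  interpret hierarchy G r "lev G r" "\<lambda>u v. direct_successor G r v u"
    using tree by (rule hierarchy_of_rooted_tree)
  define n where "n = Max (lev G r ` pverts G)"
  have fin: "finite (pverts G)" using tree by (rule finite_pverts)
  have lev_le: "lev G r v \<le> n" if "v \<in> pverts G" for v
    using that fin by (simp add: n_def)
  have "n \<in> lev G r ` pverts G" unfolding n_def using fin root_in by (intro Max_in) auto
  then obtain v0 where v0: "v0 \<in> pverts G" "lev G r v0 = n" by blast
  have deepest: "v \<in> tree_leaves G r" if v: "v \<in> pverts G" "lev G r v = n" for v
  proof -
    have "\<not> direct_successor G r w v" if "w \<in> pverts G" for w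
      using lvl_child[OF v(1) that] lev_le[OF that] v(2) by auto
    then show ?thesis using leaf_iff_no_successor[OF tree v(1)] by blast
  qed
  have leaf_lev: "lev G r v = n" if "v \<in> tree_leaves G r" for v
    using perfect that deepest[OF v0] v0(2) unfolding perfect_binary_tree_def by metis
  have pt: "perfect_tree G r (lev G r) (\<lambda>u v. direct_successor G r v u) n l"
  proof
    show "lev G r v \<le> n" if "v \<in> pverts G" for v using lev_le that .
    show "card {w \<in> pverts G. direct_successor G r w v} = 2"
      if v: "v \<in> pverts G" "lev G r v < n" for v
    proof -
      have "v \<notin> tree_leaves G r" using leaf_lev[of v] v(2) by auto
      then have "tree_out_degree G r v = 2"
        using perfect v(1) by (auto simp: perfect_binary_tree_def binary_tree_def)
      then show ?thesis using tree_out_degree_eq_card_successors[OF tree v(1)] by simp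
    qed
    show "l v = l w" if "v \<in> pverts G" "w \<in> pverts G" "lev G r v = lev G r w" for v w
      using level that by blast
    show "l w < l v" if "v \<in> pverts G" "w \<in> pverts G" "direct_successor G r w v" for v w
      using less that by blast
    show "l v = 0" if "v \<in> pverts G" "lev G r v = n" for v
      using leaf deepest that by blast
  qed
  let ?L = "{v \<in> pverts G. lev G r v = n}"
  \<comment> \<open>a carrier of the right size exists since the type is infinite\<close>
  obtain X :: "'b set" where X: "finite X" "card X = card ?L"
    using infinite_arbitrarily_large[OF infinite_UNIV] by blast
  have "finite ?L" using fin by simp
  then obtain f where f: "bij_betw f X ?L" using finite_same_card_bij[OF X(1)] X(2) by blast
  interpret leaf_space G r "lev G r" "\<lambda>u v. direct_successor G r v u" n l X f
    by (intro leaf_space.intro leaf_space_axioms.intro pt X f)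
  show ?thesis using MCD_space rep_tree_isomorphic by blast
qed

text \<open>Everything is transported from the representing tree, where the node \<open>mcball x (c j)\<close> has level
\<open>n - j\<close>, label \<open>c j\<close> and no children or two, according to whether \<open>j\<close> vanishes.\<close>

lemma perfect_labeled_tree_of_MCD:
  fixes G :: "'v pair_pre_digraph" and r :: 'v and l :: "'v \<Rightarrow> real"
  assumes tree: "rooted_tree G r"
    and "MCD_space X d"
    and "labeled_tree_isomorphic (rep_tree X d) X (mdiam d) G r l"
  shows "perfect_binary_tree G r \<and>
      (\<forall>v\<in>tree_leaves G r. l v = 0) \<and>
      (\<forall>w\<in>pverts G. \<forall>x\<in>pverts G. lev G r w = lev G r x \<longleftrightarrow> l w = l x) \<and>
      (\<forall>y\<in>pverts G. \<forall>z\<in>pverts G. direct_successor G r z y \<longrightarrow> l z < l y)"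
proof -
  obtain c n where "dyadic_space X d c n" using dyadic_of_MCD[OF assms(2)] by blast
  then interpret dyadic_space X d c n .
  have H: "hierarchy G r (lev G r) (\<lambda>u v. direct_successor G r v u)"
    using tree by (rule hierarchy_of_rooted_tree)
  then interpret hierarchy G r "lev G r" "\<lambda>u v. direct_successor G r v u" .
  let ?R = "rep_tree X d"
  have RV: "pverts ?R = rep_nodes d X" by (simp add: rep_tree_def)
  obtain F where F: "bij_betw F (pverts ?R) (pverts G)" "F X = r"
    and adj: "\<forall>u\<in>pverts ?R. \<forall>v\<in>pverts ?R. (u, v) \<in> parcs ?R \<longleftrightarrow> (F u, F v) \<in> parcs G"
    and lab: "\<forall>v\<in>pverts ?R. l (F v) = mdiam d v"
    using assms(3) unfolding labeled_tree_isomorphic_def by blast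
  note iso = rep_tree_hierarchy H F adj
  have lev_F: "lev G r (F A) = n - radius_index A" if "A \<in> rep_nodes d X" for A
    using hierarchy_lvl_isomorphic[OF iso] that RV by simp
  have succ_F: "direct_successor G r (F B) (F A) \<longleftrightarrow> splits_into d A B"
    if "A \<in> rep_nodes d X" "B \<in> rep_nodes d X" for A B
    using hierarchy_child_isomorphic[OF iso] that RV by simp
  have card_succ: "tree_out_degree G r (F A) = card {B \<in> rep_nodes d X. splits_into d A B}"
    if A: "A \<in> rep_nodes d X" for A
  proof -
    have FA: "F A \<in> pverts G" using F(1) A RV by (auto simp: bij_betw_def)
    have "{w \<in> pverts G. direct_successor G r w (F A)} = F ` {B \<in> rep_nodes d X. splits_into d A B}"
    proof -
      have "pverts G = F ` rep_nodes d X" using F(1) RV by (simp add: bij_betw_def)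
      then show ?thesis by (simp add: Compr_image_eq succ_F[OF A] cong: conj_cong)
    qed
    moreover have "inj_on F {B \<in> rep_nodes d X. splits_into d A B}"
      using F(1) RV by (auto simp: bij_betw_def intro: inj_on_subset)
    ultimately show ?thesis
      using tree_out_degree_eq_card_successors[OF tree FA] by (simp add: card_image)
  qed
  have ball: "\<exists>j\<le>n. lev G r v = n - j \<and> l v = c j \<and> tree_out_degree G r v = (if j = 0 then 0 else 2)"
    if v: "v \<in> pverts G" for v
  proof -
    obtain A where A: "A \<in> rep_nodes d X" "v = F A" using F(1) v RV by (auto simp: bij_betw_def)
    then obtain x j where xj: "x \<in> X" "j \<le> n" "A = mcball x (c j)" by (auto simp: rep_nodes_eq)
    have "lev G r v = n - j" using lev_F A xj radius_index_mcball by simp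
    moreover have "l v = c j" using lab A xj mdiam_mcball RV by simp
    moreover have "card {B \<in> rep_nodes d X. splits_into d A B} = (if j = 0 then 0 else 2)"
    proof (cases j)
      case 0
      then show ?thesis using not_splits_mcball_zero[OF xj(1)] xj(3) by simp
    next
      case (Suc i)
      then show ?thesis using two_children[OF xj(1), of i] xj by simp
    qed
    then have "tree_out_degree G r v = (if j = 0 then 0 else 2)" using card_succ A by simp
    ultimately show ?thesis using xj(2) by blast
  qed
  have leaf: "lev G r v = n \<and> l v = 0" if v: "v \<in> tree_leaves G r" for v
  proof -
    have "v \<in> pverts G" "tree_out_degree G r v = 0" using v by (auto simp: tree_leaves_def)
    then show ?thesis using ball[of v] scale_zero by (auto split: if_splits)
  qed
  have "binary_tree G r"
    unfolding binary_tree_def tree_leaves_def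
  proof (intro conjI ballI tree)
    fix v assume "v \<in> pverts G"
    then show "v \<in> {v \<in> pverts G. tree_out_degree G r v = 0} \<or> tree_out_degree G r v = 2"
      using ball[of v] by (auto split: if_splits)
  qed
  then have "perfect_binary_tree G r" using leaf by (simp add: perfect_binary_tree_def)
  moreover have "\<forall>v\<in>tree_leaves G r. l v = 0" using leaf by blast
  moreover have "lev G r w = lev G r x \<longleftrightarrow> l w = l x" if wx: "w \<in> pverts G" "x \<in> pverts G" for w x
  proof -
    obtain i j where "i \<le> n" "lev G r w = n - i" "l w = c i" "j \<le> n" "lev G r x = n - j" "l x = c j"
      using ball[OF wx(1)] ball[OF wx(2)] by blast
    then show ?thesis using scale_eq_iff[of i j] by auto
  qed
  moreover have "l z < l y" if yz: "y \<in> pverts G" "z \<in> pverts G" "direct_successor G r z y" for y z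
  proof -
    obtain i j where ij: "i \<le> n" "lev G r y = n - i" "l y = c i" "j \<le> n" "lev G r z = n - j" "l z = c j"
      using ball[OF yz(1)] ball[OF yz(2)] by blast
    then have "j < i" using lvl_child[OF yz] by arith
    then show ?thesis using scale_less ij by simp
  qed
  ultimately show ?thesis by blast
qed

theorem theorem4p1:
  fixes G :: "'v pair_pre_digraph" and r :: 'v and l :: "'v \<Rightarrow> real"
  assumes "rooted_tree G r"
    and "\<forall>v\<in>pverts G. 0 \<le> l v"
  shows
    "(perfect_binary_tree G r \<and>
      (\<forall>v\<in>tree_leaves G r. l v = 0) \<and>
      (\<forall>w\<in>pverts G. \<forall>x\<in>pverts G. lev G r w = lev G r x \<longleftrightarrow> l w = l x) \<and>
      (\<forall>y\<in>pverts G. \<forall>z\<in>pverts G. direct_successor G r z y \<longrightarrow> l z < l y))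
     \<longleftrightarrow>
     (\<exists>(X :: 'b::infinite set) (d :: 'b \<Rightarrow> 'b \<Rightarrow> real).
        MCD_space X d \<and>
        labeled_tree_isomorphic (rep_tree X d) X (mdiam d) G r l)"
  (is "?perfect \<longleftrightarrow> ?MCD")
proof
  assume ?perfect
  then show ?MCD using MCD_of_perfect_labeled_tree[OF assms(1)] by blast
next
  assume ?MCD
  then obtain X :: "'b set" and d where
    "MCD_space X d" "labeled_tree_isomorphic (rep_tree X d) X (mdiam d) G r l" by blast
  then show ?perfect by (rule perfect_labeled_tree_of_MCD[OF assms(1)])
qed

end
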